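(* Hyper Hoare Logic is complete: for all hyper-assertions $P,Q$ and every command $C$, if $\models \{P\}\,C\,\{Q\}$ then $\vdash \{P\}\,C\,\{Q\}$.
   Context: Fix sets $\mathit{PVars}$ (program variables), $\mathit{PVals}$ (program values), $\mathit{LVars}$ (logical variables), $\mathit{LVals}$ (logical values). Program states are total functions $\sigma:\mathit{PVars}\to\mathit{PVals}$. Commands are given by $C ::= \mathbf{skip} \mid x:=e \mid x:=\mathrm{nonDet}() \mid \mathbf{assume}\ b \mid C;C \mid C+C \mid C^{*}$, where $x\in\mathit{PVars}$, expressions $e$ are total functions from program states to $\mathit{PVals}$, and $b$ are total functions from program states to Booleans. The big-step relation $\langle C,\sigma\rangle\to\sigma'$ is defined inductively: $\langle\mathbf{skip},\sigma\rangle\to\sigma$; $\langle x:=e,\sigma\rangle\to\sigma[x\mapsto e(\sigma)]$; $\langle x:=\mathrm{nonDet}(),\sigma\rangle\to\sigma[x\mapsto v]$ for every $v$; $\langle \mathbf{assume}\ b,\sigma\rangle\to\sigma$ if $b(\sigma)$; $\langle C_1;C_2,\sigma\rangle\to\sigma''$ if $\langle C_1,\sigma\rangle\to\sigma'$ and $\langle C_2,\sigma'\rangle\to\sigma''$; $\langle C_1+C_2,\sigma\rangle\to\sigma'$ if $\langle C_1,\sigma\rangle\to\sigma'$ or $\langle C_2,\sigma\rangle\to\sigma'$; $\langle C^*,\sigma\rangle\to\sigma$; and $\langle C^*,\sigma\rangle\to\sigma''$ if $\langle C,\sigma\rangle\to\sigma'$ and $\langle C^*,\sigma'\rangle\to\sigma''$.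 An extended state is a pair $\varphi=(\varphi^L,\varphi^P)$ of a logical state $\varphi^L:\mathit{LVars}\to\mathit{LVals}$ and a program state $\varphi^P$. For a set $S$ of extended states, $\mathit{sem}(C,S)=\{\varphi\mid \exists\sigma.\ (\varphi^L,\sigma)\in S\wedge \langle C,\sigma\rangle\to\varphi^P\}$. A hyper-assertion is a total function from sets of extended states to Booleans; $P\models Q$ means $\forall S.\ P(S)\Rightarrow Q(S)$. Validity: $\models\{P\}C\{Q\}$ iff for all sets $S$ of extended states, $P(S)$ implies $Q(\mathit{sem}(C,S))$. Define $(Q_1\otimes Q_2)(S)$ iff $\exists S_1,S_2.\ S=S_1\cup S_2\wedge Q_1(S_1)\wedge Q_2(S_2)$, and for a family $(I_n)_{n\in\mathbb N}$, $(\bigotimes_{n\in\mathbb N} I_n)(S)$ iff there is $f:\mathbb N\to$ sets of extended states with $S=\bigcup_n f(n)$ and $I_n(f(n))$ for all $n$. Derivability $\vdash\{P\}C\{Q\}$ is the least relation closed under the rules: (Skip) $\vdash\{P\}\mathbf{skip}\{P\}$; (Seq) from $\vdash\{P\}C_1\{R\}$ and $\vdash\{R\}C_2\{Q\}$ infer $\vdash\{P\}C_1;C_2\{Q\}$; (Choice) from $\vdash\{P\}C_1\{Q_1\}$ and $\vdash\{P\}C_2\{Q_2\}$ infer $\vdash\{P\}C_1+C_2\{Q_1\otimes Q_2\}$; (Cons) from $P\models P'$, $Q'\models Q$ and $\vdash\{P'\}C\{Q'\}$ infer $\vdash\{P\}C\{Q\}$; (Assume) $\vdash\{\lambda S.\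 P(\{\varphi\in S\mid b(\varphi^P)\})\}\,\mathbf{assume}\ b\,\{P\}$; (Exist) from $\vdash\{P(x)\}C\{Q(x)\}$ for all $x$ (of an arbitrary type) infer $\vdash\{\lambda S.\exists x.P(x)(S)\}C\{\lambda S.\exists x.Q(x)(S)\}$; (Assign) $\vdash\{\lambda S.\ P(\{\varphi\mid\exists\alpha\in S.\ \varphi^L=\alpha^L\wedge\varphi^P=\alpha^P[x\mapsto e(\alpha^P)]\})\}\,x:=e\,\{P\}$; (Iter) from $\vdash\{I_n\}C\{I_{n+1}\}$ for all $n\in\mathbb N$ infer $\vdash\{I_0\}C^*\{\bigotimes_{n\in\mathbb N}I_n\}$; (Havoc) $\vdash\{\lambda S.\ P(\{\varphi\mid\exists\alpha\in S.\exists v.\ \varphi^L=\alpha^L\wedge\varphi^P=\alpha^P[x\mapsto v]\})\}\,x:=\mathrm{nonDet}()\,\{P\}$. *)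

theory Defs
  imports Main
begin

type_synonym ('pvar, 'pval) pstate = "'pvar \<Rightarrow> 'pval"
type_synonym ('lvar, 'lval) lstate = "'lvar \<Rightarrow> 'lval"
type_synonym ('lvar, 'lval, 'pvar, 'pval) ext_state =
  "('lvar, 'lval) lstate \<times> ('pvar, 'pval) pstate"
type_synonym ('lvar, 'lval, 'pvar, 'pval) hyper_assertion =
  "('lvar, 'lval, 'pvar, 'pval) ext_state set \<Rightarrow> bool"

datatype ('pvar, 'pval) cmd =
    Skip
  | Assign 'pvar "('pvar, 'pval) pstate \<Rightarrow> 'pval"
  | Havoc 'pvar
  | Assume "('pvar, 'pval) pstate \<Rightarrow> bool"
  | Seq "('pvar, 'pval) cmd" "('pvar, 'pval) cmd"
  | Choice "('pvar, 'pval) cmd" "('pvar, 'pval) cmd"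
  | Iter "('pvar, 'pval) cmd"

inductive big_step ::
  "('pvar, 'pval) cmd \<Rightarrow> ('pvar, 'pval) pstate \<Rightarrow> ('pvar, 'pval) pstate \<Rightarrow> bool"
  (\<open>\<langle>_, _\<rangle> \<rightarrow> _\<close> [0, 0, 51] 50)
where
  big_skip: "\<langle>Skip, \<sigma>\<rangle> \<rightarrow> \<sigma>"
| big_assign: "\<langle>Assign x e, \<sigma>\<rangle> \<rightarrow> \<sigma>(x := e \<sigma>)"
| big_havoc: "\<langle>Havoc x, \<sigma>\<rangle> \<rightarrow> \<sigma>(x := v)"
| big_assume: "b \<sigma> \<Longrightarrow> \<langle>Assume b, \<sigma>\<rangle> \<rightarrow> \<sigma>"
| big_seq: "\<langle>C1, \<sigma>\<rangle> \<rightarrow> \<sigma>' \<Longrightarrow> \<langle>C2, \<sigma>'\<rangle> \<rightarrow> \<sigma>'' \<Longrightarrow> \<langle>Seq C1 C2, \<sigma>\<rangle> \<rightarrow> \<sigma>''"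
| big_choice1: "\<langle>C1, \<sigma>\<rangle> \<rightarrow> \<sigma>' \<Longrightarrow> \<langle>Choice C1 C2, \<sigma>\<rangle> \<rightarrow> \<sigma>'"
| big_choice2: "\<langle>C2, \<sigma>\<rangle> \<rightarrow> \<sigma>' \<Longrightarrow> \<langle>Choice C1 C2, \<sigma>\<rangle> \<rightarrow> \<sigma>'"
| big_iter_stop: "\<langle>Iter C, \<sigma>\<rangle> \<rightarrow> \<sigma>"
| big_iter_step: "\<langle>C, \<sigma>\<rangle> \<rightarrow> \<sigma>' \<Longrightarrow> \<langle>Iter C, \<sigma>'\<rangle> \<rightarrow> \<sigma>'' \<Longrightarrow> \<langle>Iter C, \<sigma>\<rangle> \<rightarrow> \<sigma>''"

definition sem ::
  "('pvar, 'pval) cmd \<Rightarrow> ('lvar, 'lval, 'pvar, 'pval) ext_state set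
    \<Rightarrow> ('lvar, 'lval, 'pvar, 'pval) ext_state set"
where
  "sem C S = {\<phi>. \<exists>\<sigma>. (fst \<phi>, \<sigma>) \<in> S \<and> \<langle>C, \<sigma>\<rangle> \<rightarrow> snd \<phi>}"

definition entails ::
  "('lvar, 'lval, 'pvar, 'pval) hyper_assertion
    \<Rightarrow> ('lvar, 'lval, 'pvar, 'pval) hyper_assertion \<Rightarrow> bool"
where
  "entails P Q \<longleftrightarrow> (\<forall>S. P S \<longrightarrow> Q S)"

definition valid_triple ::
  "('lvar, 'lval, 'pvar, 'pval) hyper_assertion \<Rightarrow> ('pvar, 'pval) cmd
    \<Rightarrow> ('lvar, 'lval, 'pvar, 'pval) hyper_assertion \<Rightarrow> bool"
  (\<open>\<Turnstile> \<lbrace>_\<rbrace> _ \<lbrace>_\<rbrace>\<close> [0, 0, 0] 50)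
where
  "\<Turnstile> \<lbrace>P\<rbrace> C \<lbrace>Q\<rbrace> \<longleftrightarrow> (\<forall>S. P S \<longrightarrow> Q (sem C S))"

definition otimes ::
  "('lvar, 'lval, 'pvar, 'pval) hyper_assertion
    \<Rightarrow> ('lvar, 'lval, 'pvar, 'pval) hyper_assertion
    \<Rightarrow> ('lvar, 'lval, 'pvar, 'pval) hyper_assertion"
where
  "otimes Q1 Q2 = (\<lambda>S. \<exists>S1 S2. S = S1 \<union> S2 \<and> Q1 S1 \<and> Q2 S2)"

definition big_otimes ::
  "(nat \<Rightarrow> ('lvar, 'lval, 'pvar, 'pval) hyper_assertion)
    \<Rightarrow> ('lvar, 'lval, 'pvar, 'pval) hyper_assertion"
where
  "big_otimes I = (\<lambda>S. \<exists>f. S = (\<Union>n. f n) \<and> (\<forall>n. I n (f n)))"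

text \<open>
  The rule \<open>Exist\<close> is meant for families \<open>P x\<close>, \<open>Q x\<close> with \<open>x\<close> ranging over an arbitrary type,
  but a rule of an inductive predicate cannot quantify over types. Indexing by pairs of
  hyper-assertions loses nothing: what the rule says depends only on the set of pairs
  \<open>(P x, Q x)\<close>, and every nonempty set of pairs is the range of a family indexed by pairs.
  The rule for an arbitrary index type is the lemma \<open>derivable_exist\<close> below.
\<close>

inductive derivable ::
  "('lvar, 'lval, 'pvar, 'pval) hyper_assertion \<Rightarrow> ('pvar, 'pval) cmd
    \<Rightarrow> ('lvar, 'lval, 'pvar, 'pval) hyper_assertion \<Rightarrow> bool"
  (\<open>\<turnstile> \<lbrace>_\<rbrace> _ \<lbrace>_\<rbrace>\<close> [0, 0, 0] 50)
where
  Rule_Skip: "\<turnstile> \<lbrace>P\<rbrace> Skip \<lbrace>P\<rbrace>"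
| Rule_Seq: "\<turnstile> \<lbrace>P\<rbrace> C1 \<lbrace>R\<rbrace> \<Longrightarrow> \<turnstile> \<lbrace>R\<rbrace> C2 \<lbrace>Q\<rbrace> \<Longrightarrow> \<turnstile> \<lbrace>P\<rbrace> Seq C1 C2 \<lbrace>Q\<rbrace>"
| Rule_Choice: "\<turnstile> \<lbrace>P\<rbrace> C1 \<lbrace>Q1\<rbrace> \<Longrightarrow> \<turnstile> \<lbrace>P\<rbrace> C2 \<lbrace>Q2\<rbrace> \<Longrightarrow> \<turnstile> \<lbrace>P\<rbrace> Choice C1 C2 \<lbrace>otimes Q1 Q2\<rbrace>"
| Rule_Cons: "entails P P' \<Longrightarrow> entails Q' Q \<Longrightarrow> \<turnstile> \<lbrace>P'\<rbrace> C \<lbrace>Q'\<rbrace> \<Longrightarrow> \<turnstile> \<lbrace>P\<rbrace> C \<lbrace>Q\<rbrace>"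
| Rule_Assume: "\<turnstile> \<lbrace>\<lambda>S. P {\<phi> \<in> S. b (snd \<phi>)}\<rbrace> Assume b \<lbrace>P\<rbrace>"
| Rule_Exist:
    "(\<And>x :: ('lvar, 'lval, 'pvar, 'pval) hyper_assertion
             \<times> ('lvar, 'lval, 'pvar, 'pval) hyper_assertion. \<turnstile> \<lbrace>P x\<rbrace> C \<lbrace>Q x\<rbrace>)
      \<Longrightarrow> \<turnstile> \<lbrace>\<lambda>S. \<exists>x. P x S\<rbrace> C \<lbrace>\<lambda>S. \<exists>x. Q x S\<rbrace>"
| Rule_Assign:
    "\<turnstile> \<lbrace>\<lambda>S. P {\<phi>. \<exists>\<alpha>\<in>S. fst \<phi> = fst \<alpha> \<and> snd \<phi> = (snd \<alpha>)(x := e (snd \<alpha>))}\<rbrace> Assign x e \<lbrace>P\<rbrace>"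
| Rule_Iter: "(\<And>n :: nat. \<turnstile> \<lbrace>I n\<rbrace> C \<lbrace>I (Suc n)\<rbrace>) \<Longrightarrow> \<turnstile> \<lbrace>I 0\<rbrace> Iter C \<lbrace>big_otimes I\<rbrace>"
| Rule_Havoc:
    "\<turnstile> \<lbrace>\<lambda>S. P {\<phi>. \<exists>\<alpha>\<in>S. \<exists>v. fst \<phi> = fst \<alpha> \<and> snd \<phi> = (snd \<alpha>)(x := v)}\<rbrace> Havoc x \<lbrace>P\<rbrace>"

lemma derivable_exist:
  fixes P Q :: "'i \<Rightarrow> ('lvar, 'lval, 'pvar, 'pval) hyper_assertion"
  assumes "\<And>x. \<turnstile> \<lbrace>P x\<rbrace> C \<lbrace>Q x\<rbrace>"
  shows "\<turnstile> \<lbrace>\<lambda>S. \<exists>x. P x S\<rbrace> C \<lbrace>\<lambda>S. \<exists>x. Q x S\<rbrace>"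
proof -
  let ?g = "inv (\<lambda>x. (P x, Q x))"
  have g: "P (?g (P x, Q x)) = P x" "Q (?g (P x, Q x)) = Q x" for x
    using f_inv_into_f[of "(P x, Q x)" "\<lambda>x. (P x, Q x)" UNIV] by auto
  have eq: "(\<lambda>S. \<exists>p. P (?g p) S) = (\<lambda>S. \<exists>x. P x S)" "(\<lambda>S. \<exists>p. Q (?g p) S) = (\<lambda>S. \<exists>x. Q x S)"
    using g by (metis (no_types))+
  have "\<turnstile> \<lbrace>\<lambda>S. \<exists>p. P (?g p) S\<rbrace> C \<lbrace>\<lambda>S. \<exists>p. Q (?g p) S\<rbrace>"
    by (rule Rule_Exist) (rule assms)
  then show ?thesis
    unfolding eq .
qed

end

(* For a fixed set V of extended states, the rules derive the exact triple
   {S = V} C {S = sem C V}: the only delicate case is Iter, where the n-th invariant pins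
   the set down to the n-fold iterate of sem C at V. Applying Exist to these triples over all V
   satisfying P then gives any valid triple. *)

theory Submission
  imports Defs
begin

inductive_cases big_skipE: "\<langle>Skip, \<sigma>\<rangle> \<rightarrow> \<sigma>'"
inductive_cases big_assignE: "\<langle>Assign x e, \<sigma>\<rangle> \<rightarrow> \<sigma>'"
inductive_cases big_havocE: "\<langle>Havoc x, \<sigma>\<rangle> \<rightarrow> \<sigma>'"
inductive_cases big_assumeE: "\<langle>Assume b, \<sigma>\<rangle> \<rightarrow> \<sigma>'"
inductive_cases big_seqE: "\<langle>Seq C1 C2, \<sigma>\<rangle> \<rightarrow> \<sigma>'"
inductive_cases big_choiceE: "\<langle>Choice C1 C2, \<sigma>\<rangle> \<rightarrow> \<sigma>'"

lemma sem_Skip: "sem Skip S = S"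
  by (fastforce simp: sem_def intro: big_skip elim: big_skipE)

lemma sem_Assign:
  "sem (Assign x e) S = {\<phi>. \<exists>\<alpha>\<in>S. fst \<phi> = fst \<alpha> \<and> snd \<phi> = (snd \<alpha>)(x := e (snd \<alpha>))}"
  by (force simp: sem_def intro: big_assign elim: big_assignE)

lemma sem_Havoc:
  "sem (Havoc x) S = {\<phi>. \<exists>\<alpha>\<in>S. \<exists>v. fst \<phi> = fst \<alpha> \<and> snd \<phi> = (snd \<alpha>)(x := v)}"
  by (force simp: sem_def intro: big_havoc elim: big_havocE)

lemma sem_Assume: "sem (Assume b) S = {\<phi> \<in> S. b (snd \<phi>)}"
  by (fastforce simp: sem_def intro: big_assume elim: big_assumeE)

lemma sem_Seq: "sem (Seq C1 C2) S = sem C2 (sem C1 S)"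
  by (auto simp: sem_def intro: big_seq elim!: big_seqE)

lemma sem_Choice: "sem (Choice C1 C2) S = sem C1 S \<union> sem C2 S"
  by (auto simp: sem_def intro: big_choice1 big_choice2 elim!: big_choiceE)

text \<open>After a first run of \<open>C\<close> the remaining iterations start from
  \<open>sem C S\<close>, so the induction leaves \<open>S\<close> arbitrary.\<close>

lemma big_step_Iter_imp_funpow:
  assumes "\<langle>Iter C, \<sigma>\<rangle> \<rightarrow> \<sigma>'" and "(l, \<sigma>) \<in> S"
  shows "\<exists>n. (l, \<sigma>') \<in> (sem C ^^ n) S"
  using assms
proof (induction "Iter C" \<sigma> \<sigma>' arbitrary: S rule: big_step.induct)
  case (big_iter_stop \<sigma>)
  then have "(l, \<sigma>) \<in> (sem C ^^ 0) S"
    by simp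
  then show ?case ..
next
  case (big_iter_step \<sigma> \<sigma>' \<sigma>'')
  then have "(l, \<sigma>') \<in> sem C S"
    by (auto simp: sem_def)
  then obtain n where "(l, \<sigma>'') \<in> (sem C ^^ n) (sem C S)"
    using big_iter_step by blast
  \<comment> \<open>The loop unrolls at its front, so the innermost \<open>sem C\<close> is split
    off, not the outermost one as in \<open>funpow.simps\<close>.\<close>
  then have "(l, \<sigma>'') \<in> (sem C ^^ Suc n) S"
    by (simp add: funpow_Suc_right del: funpow.simps)
  then show ?case ..
qed

lemma funpow_sem_subset_Iter: "(sem C ^^ n) S \<subseteq> sem (Iter C) S"
proof (induction n arbitrary: S)
  case 0
  show ?case
    by (fastforce simp: sem_def intro: big_iter_stop)
next
  case (Suc n)
  have "(sem C ^^ Suc n) S \<subseteq> sem (Iter C) (sem C S)"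
    using Suc.IH by (simp add: funpow_Suc_right del: funpow.simps)
  also have "\<dots> \<subseteq> sem (Iter C) S"
    by (auto simp: sem_def intro: big_iter_step)
  finally show ?case .
qed

lemma sem_Iter: "sem (Iter C) S = (\<Union>n. (sem C ^^ n) S)"
proof
  show "sem (Iter C) S \<subseteq> (\<Union>n. (sem C ^^ n) S)"
    by (auto simp: sem_def[of "Iter C"] dest: big_step_Iter_imp_funpow)
  show "(\<Union>n. (sem C ^^ n) S) \<subseteq> sem (Iter C) S"
    by (rule UN_least) (rule funpow_sem_subset_Iter)
qed

lemma derivable_strengthen_pre:
  assumes "\<turnstile> \<lbrace>P'\<rbrace> C \<lbrace>Q\<rbrace>" and "\<And>S. P S \<Longrightarrow> P' S"
  shows "\<turnstile> \<lbrace>P\<rbrace> C \<lbrace>Q\<rbrace>"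
  using assms by (auto simp: entails_def intro: Rule_Cons[of P P' Q])

text \<open>
  The side condition \<open>b\<close> lets the same induction cover the triple with unsatisfiable
  pre- and postcondition, which is what the indices \<open>V\<close> violating \<open>P\<close> contribute to \<open>Exist\<close>.
\<close>

lemma derivable_exact:
  "\<turnstile> \<lbrace>\<lambda>S. S = V \<and> b\<rbrace> C \<lbrace>\<lambda>S. S = sem C V \<and> b\<rbrace>"
proof (induction C arbitrary: V)
  case Skip
  show ?case
    unfolding sem_Skip by (rule Rule_Skip)
next
  case (Assign x e)
  \<comment> \<open>The axiom's precondition evaluates the postcondition at exactly the set that
    \<open>sem_Assign\<close> describes, so at \<open>S = V\<close> it holds by reflexivity.
    \<open>Havoc\<close> and \<open>Assume\<close> work alike.\<close>
  show ?case
    by (rule derivable_strengthen_pre[OF Rule_Assign]) (simp add: sem_Assign)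
next
  case (Havoc x)
  show ?case
    by (rule derivable_strengthen_pre[OF Rule_Havoc]) (simp add: sem_Havoc)
next
  case (Assume p)
  show ?case
    by (rule derivable_strengthen_pre[OF Rule_Assume]) (simp add: sem_Assume)
next
  case (Seq C1 C2)
  show ?case
    unfolding sem_Seq by (rule Rule_Seq) (rule Seq.IH)+
next
  case (Choice C1 C2)
  \<comment> \<open>Each factor admits at most one set, so the splitting of \<open>S\<close> is
    forced.\<close>
  have "otimes (\<lambda>S. S = sem C1 V \<and> b) (\<lambda>S. S = sem C2 V \<and> b)
      = (\<lambda>S. S = sem (Choice C1 C2) V \<and> b)"
    by (auto simp: otimes_def sem_Choice)
  then show ?case
    using Rule_Choice[OF Choice.IH] by metis
next
  case (Iter C)
  let ?I = "\<lambda>n S. S = (sem C ^^ n) V \<and> b"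
  \<comment> \<open>Only the sequence of iterates can witness \<open>big_otimes\<close>; its union
    is given by \<open>sem_Iter\<close>.\<close>
  have "big_otimes ?I = (\<lambda>S. S = sem (Iter C) V \<and> b)"
    by (auto simp: big_otimes_def sem_Iter fun_eq_iff)
  moreover have "\<turnstile> \<lbrace>?I 0\<rbrace> Iter C \<lbrace>big_otimes ?I\<rbrace>"
    \<comment> \<open>The induction hypothesis is used with the n-th iterate in place of
      \<open>V\<close>.\<close>
    by (rule Rule_Iter) (simp add: Iter.IH)
  ultimately show ?case
    by simp
qed

theorem mainTheorem2:
  fixes P Q :: "('lvar, 'lval, 'pvar, 'pval) hyper_assertion"
    and C :: "('pvar, 'pval) cmd"
  assumes "\<Turnstile> \<lbrace>P\<rbrace> C \<lbrace>Q\<rbrace>"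
  shows "\<turnstile> \<lbrace>P\<rbrace> C \<lbrace>Q\<rbrace>"
proof (rule Rule_Cons)
  \<comment> \<open>Taking \<open>P V\<close> for \<open>b\<close> restricts the existential to sets
    satisfying \<open>P\<close>, while the index \<open>V\<close> ranges over all sets, as
    \<open>derivable_exist\<close> demands.\<close>
  show "\<turnstile> \<lbrace>\<lambda>S. \<exists>V. S = V \<and> P V\<rbrace> C \<lbrace>\<lambda>S. \<exists>V. S = sem C V \<and> P V\<rbrace>"
    by (rule derivable_exist) (rule derivable_exact)
  show "entails P (\<lambda>S. \<exists>V. S = V \<and> P V)"
    by (simp add: entails_def)
  show "entails (\<lambda>S. \<exists>V. S = sem C V \<and> P V) Q"
    using assms by (auto simp: entails_def valid_triple_def)
qed

end
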